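(* For every integer $d\geq 0$ and every real $\varepsilon>0$, there exists a constant $c=c(d,\varepsilon)\geq 1$ such that for every graph $G$ on $n$ vertices satisfying $\mathrm{mad}(G)\leq d-\varepsilon$ and for every integer $k\geq d+1$, we have $\mathrm{diam}(\mathcal{C}_{k}(G))=O(n^c)$, where the implied constant depends only on $d$ and $\varepsilon$.
   Context: Graphs are finite and simple (with at least one vertex). The maximum average degree of $G$ is $\mathrm{mad}(G)=\max_{\emptyset \neq H\subseteq G} \frac{2|E(H)|}{|V(H)|}$, the maximum being over non-empty subgraphs $H$ of $G$. A proper $k$-coloring of $G=(V,E)$ is a function $f:V\to\{1,\dots,k\}$ such that $f(x)\ne f(y)$ for every edge $xy\in E$. The $k$-recoloring graph $\mathcal{C}_k(G)$ is the graph whose vertices are the proper $k$-colorings of $G$, two colorings being adjacent if they differ on exactly one vertex of $G$. The diameter $\mathrm{diam}(\mathcal{C}_k(G))$ is the maximum distance between two vertices of $\mathcal{C}_k(G)$, the distance being infinite when there is no path. *)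

theory Defs
  imports Complex_Main "HOL-Library.FuncSet" "Graph_Theory.Graph_Theory"
begin

text \<open>
  A finite simple graph is a \<open>pair_graph\<close>: each undirected edge is represented by two
  opposite arcs.  The set of undirected edges is recovered as follows.
\<close>

definition uedges :: "'a pair_pre_digraph \<Rightarrow> 'a set set" where
  "uedges G = {{u, v} | u v. (u, v) \<in> parcs G}"

text \<open>
  \<open>subgraph\<close> alone would also admit asymmetric sets of arcs; \<open>pair_graph H\<close> restricts it to
  subgraphs in the undirected sense.
\<close>

definition nonempty_subgraphs :: "'a pair_pre_digraph \<Rightarrow> 'a pair_pre_digraph set" where
  "nonempty_subgraphs G =
     {H. pair_graph H \<and> subgraph (with_proj H) (with_proj G) \<and> pverts H \<noteq> {}}"

definition mad :: "'a pair_pre_digraph \<Rightarrow> real" where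
  "mad G = Max ((\<lambda>H. 2 * real (card (uedges H)) / real (card (pverts H))) ` nonempty_subgraphs G)"

lemma finite_nonempty_subgraphs:
  assumes "pair_graph G"
  shows "finite (nonempty_subgraphs G)"
proof -
  interpret pair_graph G by fact
  let ?F = "(\<lambda>(V, A). \<lparr>pverts = V, parcs = A\<rparr>) ` (Pow (pverts G) \<times> Pow (parcs G))"
  have "nonempty_subgraphs G \<subseteq> ?F"
  proof
    fix H assume "H \<in> nonempty_subgraphs G"
    then have "pverts H \<subseteq> pverts G" "parcs H \<subseteq> parcs G"
      by (auto simp: nonempty_subgraphs_def subgraph_def)
    then have "(pverts H, parcs H) \<in> Pow (pverts G) \<times> Pow (parcs G)" by simp
    moreover have "H = (\<lambda>(V, A). \<lparr>pverts = V, parcs = A\<rparr>) (pverts H, parcs H)" by simp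
    ultimately show "H \<in> ?F" by (rule rev_image_eqI)
  qed
  moreover have "finite ?F" using pair_finite_verts pair_finite_arcs by simp
  ultimately show ?thesis by (rule finite_subset)
qed

lemma self_in_nonempty_subgraphs:
  assumes "pair_graph G" "pverts G \<noteq> {}"
  shows "G \<in> nonempty_subgraphs G"
proof -
  interpret pair_graph G by fact
  show ?thesis
    using assms wf_digraph by (auto simp: nonempty_subgraphs_def subgraph_def compatible_def)
qed

text \<open>
  Colorings are extensional functions, so that two of them are equal iff they agree on all
  vertices.
\<close>

definition proper_colorings :: "nat \<Rightarrow> 'a pair_pre_digraph \<Rightarrow> ('a \<Rightarrow> nat) set" where
  "proper_colorings k G =
     {f \<in> pverts G \<rightarrow>\<^sub>E {1..k}. \<forall>(x, y) \<in> parcs G. f x \<noteq> f y}"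

definition recoloring_graph :: "nat \<Rightarrow> 'a pair_pre_digraph \<Rightarrow> ('a \<Rightarrow> nat) pair_pre_digraph" where
  "recoloring_graph k G =
     \<lparr> pverts = proper_colorings k G,
       parcs = {(f, g). f \<in> proper_colorings k G \<and> g \<in> proper_colorings k G \<and>
                        (\<exists>!x. x \<in> pverts G \<and> f x \<noteq> g x)} \<rparr>"

lemma pair_graph_recoloring_graph:
  assumes "finite (pverts G)"
  shows "pair_graph (recoloring_graph k G)"
proof -
  let ?P = "proper_colorings k G"
  have fin: "finite ?P"
    using finite_PiE[OF assms, of "\<lambda>_. {1..k}"]
    by (rule rev_finite_subset) (auto simp: proper_colorings_def)
  have "finite (parcs (recoloring_graph k G))"
    by (rule finite_subset[of _ "?P \<times> ?P"]) (auto simp: recoloring_graph_def fin)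
  moreover have "sym (parcs (recoloring_graph k G))"
    by (rule symI) (auto simp: recoloring_graph_def eq_commute)
  ultimately show ?thesis
    by unfold_locales (auto simp: recoloring_graph_def fin symmetric_def)
qed

text \<open>
  With unit weights, \<open>wf_digraph.\<mu>\<close> is the length of a shortest walk, and \<open>\<infinity>\<close> if there is none.
\<close>

definition graph_dist :: "'a pair_pre_digraph \<Rightarrow> 'a \<Rightarrow> 'a \<Rightarrow> ereal" where
  "graph_dist G u v = wf_digraph.\<mu> (with_proj G) (\<lambda>_. 1) u v"

definition graph_diameter :: "'a pair_pre_digraph \<Rightarrow> ereal" where
  "graph_diameter G = (SUP (u, v) \<in> pverts G \<times> pverts G. graph_dist G u v)"

end

theory Submission
  imports Defs
begin

text \<open>
  The idea is to peel the graph by independent sets of vertices of small degree.  Since every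
  subgraph on a vertex set \<open>W\<close> has average degree at most \<open>d - \<epsilon>\<close>, at least
  \<open>(\<epsilon> / d) |W|\<close> vertices have fewer than \<open>d\<close> neighbours in \<open>W\<close>, and a maximal independent
  subset \<open>S\<close> of these still contains at least \<open>(\<epsilon> / d\<^sup>2) |W|\<close> vertices
  (\<open>large_independent_low_degree_set\<close>).

  Suppose that \<open>W - S\<close> can be recolored.  The same sequence of moves can be performed in \<open>W\<close>
  (\<open>recolors_extend\<close>): whenever a vertex is about to receive the current color of some neighbours
  in \<open>S\<close>, these neighbours step aside first.  This is possible because a vertex of \<open>S\<close> has at most
  \<open>d - 1\<close> neighbours, all outside \<open>S\<close>, so that their colors and the color about to be used leave
  one of the \<open>k \<ge> d + 1\<close> colors free.  At the end each vertex of \<open>S\<close> is given its target color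
  by one more move, all its neighbours having theirs.  So if the vertices of \<open>W - S\<close> move at most
  \<open>R\<close> times each, those of \<open>S\<close> move at most \<open>(d - 1) R + 1\<close> times each.

  The factor is thus at most \<open>d\<close> for each peeled layer, while the number of remaining vertices
  shrinks by the factor \<open>q = 1 - \<epsilon> / d\<^sup>2 < 1\<close>.  If \<open>a\<close> is chosen with \<open>d q\<^sup>a \<le> 1\<close>, then
  \<open>|W|\<^sup>a\<close> moves per vertex suffice (\<open>recolors_bounded\<close>): equivalently, there are only
  logarithmically many layers, so that the exponential growth in the number of layers is polynomial
  in the number of vertices.  Summing over the vertices bounds the diameter by \<open>n\<^bsup>a+1\<^esup>\<close>.
\<close>

section \<open>Independent sets of vertices of low degree\<close>

definition nbrs :: "('a \<times> 'a) set \<Rightarrow> 'a set \<Rightarrow> 'a \<Rightarrow> 'a set" where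
  "nbrs E W v = {w \<in> W. (v, w) \<in> E}"

definition independent :: "('a \<times> 'a) set \<Rightarrow> 'a set \<Rightarrow> bool" where
  "independent E S \<longleftrightarrow> (\<forall>x\<in>S. \<forall>y\<in>S. (x, y) \<notin> E)"

lemma finite_nbrs [simp]: "finite W \<Longrightarrow> finite (nbrs E W v)"
  by (simp add: nbrs_def)

lemma card_edges_eq_sum_degrees:
  assumes "finite W"
  shows "card (E \<inter> W \<times> W) = (\<Sum>v\<in>W. card (nbrs E W v))"
proof -
  have "E \<inter> W \<times> W = (SIGMA v:W. nbrs E W v)"
    by (auto simp: nbrs_def)
  then show ?thesis
    using assms by (simp add: card_SigmaI)
qed

lemma many_low_degree_vertices:
  fixes \<epsilon> :: real
  assumes "finite W" "real (card (E \<inter> W \<times> W)) \<le> (real d - \<epsilon>) * real (card W)"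
  shows "\<epsilon> * real (card W) \<le> real d * real (card {v \<in> W. card (nbrs E W v) < d})"
proof -
  let ?A = "{v \<in> W. card (nbrs E W v) < d}"
  have "card (W - ?A) * d = (\<Sum>v\<in>W - ?A. d)"
    by simp
  also have "\<dots> \<le> (\<Sum>v\<in>W - ?A. card (nbrs E W v))"
    by (rule sum_mono) auto
  also have "\<dots> \<le> (\<Sum>v\<in>W. card (nbrs E W v))"
    using assms(1) by (intro sum_mono2) auto
  also have "\<dots> = card (E \<inter> W \<times> W)"
    using card_edges_eq_sum_degrees[OF assms(1), of E] by simp
  finally have "real (card (W - ?A)) * real d \<le> real (card (E \<inter> W \<times> W))"
    by (simp flip: of_nat_mult)
  moreover have "real (card (W - ?A)) = real (card W) - real (card ?A)"
    using assms(1) by (simp add: card_Diff_subset card_mono of_nat_diff)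
  ultimately show ?thesis
    using assms(2) by (simp add: algebra_simps)
qed

text \<open>
  A maximal independent subset dominates \<open>A\<close>, and each of its elements dominates itself and fewer
  than \<open>d\<close> neighbours.
\<close>

lemma large_independent_subset:
  assumes "finite A" and "sym E" and "irrefl E"
    and deg: "\<And>v. v \<in> A \<Longrightarrow> card (nbrs E A v) < d"
  obtains S where "S \<subseteq> A" "independent E S" "card A \<le> d * card S"
proof -
  let ?I = "{S \<in> Pow A. independent E S}"
  have "finite ?I" "{} \<in> ?I"
    using assms(1) by (auto simp: independent_def)
  then have "\<exists>S\<in>?I. \<forall>T\<in>?I. S \<subseteq> T \<longrightarrow> S = T"
    by (intro finite_has_maximal) auto
  then obtain S where S: "S \<in> ?I" and max: "\<forall>T\<in>?I. S \<subseteq> T \<longrightarrow> S = T"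
    by (rule bexE)
  have "finite S"
    using S assms(1) by (auto intro: finite_subset)
  have "A \<subseteq> (\<Union>s\<in>S. insert s (nbrs E A s))"
  proof
    fix v assume v: "v \<in> A"
    show "v \<in> (\<Union>s\<in>S. insert s (nbrs E A s))"
    proof (rule ccontr)
      assume not: "v \<notin> (\<Union>s\<in>S. insert s (nbrs E A s))"
      then have "\<forall>s\<in>S. (s, v) \<notin> E \<and> (v, s) \<notin> E"
        using v assms(2) by (auto simp: nbrs_def dest: symD)
      then have "insert v S \<in> ?I"
        using S v assms(3) by (auto simp: independent_def irrefl_def)
      from bspec[OF max this] have "S = insert v S"
        by (simp add: subset_insertI)
      then have "v \<in> S"
        by (metis insertI1)
      with not show False by blast
    qed
  qed
  then have "card A \<le> card (\<Union>s\<in>S. insert s (nbrs E A s))"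
    using \<open>finite S\<close> assms(1) by (intro card_mono) auto
  also have "\<dots> \<le> (\<Sum>s\<in>S. card (insert s (nbrs E A s)))"
    using \<open>finite S\<close> by (rule card_UN_le)
  also have "\<dots> \<le> of_nat (card S) * d"
  proof (rule sum_bounded_above)
    fix s assume "s \<in> S"
    then have "card (nbrs E A s) < d"
      using S deg by blast
    then show "card (insert s (nbrs E A s)) \<le> d"
      using card_insert_le_m1[of d "nbrs E A s" s] by simp
  qed
  finally have "card A \<le> d * card S"
    by (simp add: mult.commute)
  with S that show thesis by blast
qed

lemma large_independent_low_degree_set:
  fixes \<epsilon> :: real
  assumes "finite W" "sym E" "irrefl E" "d > 0"
    and sparse: "real (card (E \<inter> W \<times> W)) \<le> (real d - \<epsilon>) * real (card W)"
  obtains S where "S \<subseteq> W" "independent E S" "\<And>s. s \<in> S \<Longrightarrow> card (nbrs E W s) < d"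
    "\<epsilon> / (real d)\<^sup>2 * real (card W) \<le> real (card S)"
proof -
  let ?A = "{v \<in> W. card (nbrs E W v) < d}"
  have "card (nbrs E ?A v) < d" if "v \<in> ?A" for v
    using that assms(1) card_mono[of "nbrs E W v" "nbrs E ?A v"]
    by (force simp: nbrs_def)
  then obtain S where S: "S \<subseteq> ?A" "independent E S" "card ?A \<le> d * card S"
    using large_independent_subset[of ?A E d] assms by auto
  have "\<epsilon> * real (card W) \<le> real d * real (card ?A)"
    by (rule many_low_degree_vertices[OF assms(1) sparse])
  also have "\<dots> \<le> real d * (real d * real (card S))"
    using S(3) by (intro mult_left_mono) (simp_all flip: of_nat_mult)
  finally have "\<epsilon> / (real d)\<^sup>2 * real (card W) \<le> real (card S)"
    using assms(4) by (simp add: field_simps power2_eq_square)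
  with S that show thesis by blast
qed

section \<open>Recoloring sequences\<close>

text \<open>
  Colorings are total functions here, of which only the values on \<open>W\<close> matter: a coloring of a
  vertex set is then at the same time a coloring of its subsets.
\<close>

definition proper_on :: "('a \<times> 'a) set \<Rightarrow> nat \<Rightarrow> 'a set \<Rightarrow> ('a \<Rightarrow> nat) \<Rightarrow> bool" where
  "proper_on E k W f \<longleftrightarrow> f \<in> W \<rightarrow> {1..k} \<and> (\<forall>x\<in>W. \<forall>y\<in>W. (x, y) \<in> E \<longrightarrow> f x \<noteq> f y)"

lemma proper_on_subset: "proper_on E k W f \<Longrightarrow> W' \<subseteq> W \<Longrightarrow> proper_on E k W' f"
  unfolding proper_on_def by blast

text \<open>
  \<open>recolors E k W f n g\<close>: single-vertex moves inside \<open>W\<close> lead from \<open>f\<close> to \<open>g\<close> through colorings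
  that are proper on \<open>W\<close>, and \<open>n v\<close> is the number of moves made at \<open>v\<close>.  A move may leave the
  color of its vertex as it is.
\<close>

inductive recolors :: "('a \<times> 'a) set \<Rightarrow> nat \<Rightarrow> 'a set \<Rightarrow> ('a \<Rightarrow> nat) \<Rightarrow> ('a \<Rightarrow> nat) \<Rightarrow> ('a \<Rightarrow> nat) \<Rightarrow> bool"
  for E k W f where
  start: "proper_on E k W f \<Longrightarrow> recolors E k W f (\<lambda>_. 0) f"
| move: "recolors E k W f n g \<Longrightarrow> v \<in> W \<Longrightarrow> proper_on E k W (g(v := c))
    \<Longrightarrow> recolors E k W f (n(v := Suc (n v))) (g(v := c))"

lemma recolors_proper: "recolors E k W f n g \<Longrightarrow> proper_on E k W g"
  by (induction rule: recolors.induct)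

text \<open>
  The vertices of an independent set do not see each other's moves, so it suffices that each new
  color is compatible with the coloring before the first of these moves.
\<close>

lemma recolors_independent:
  assumes "sym E" "recolors E k W f n g" "finite T" "T \<subseteq> W" "independent E T"
    and "\<And>s. s \<in> T \<Longrightarrow> h s \<in> {1..k}"
    and "\<And>s. s \<in> T \<Longrightarrow> h s \<notin> g ` nbrs E W s"
  shows "recolors E k W f (\<lambda>x. if x \<in> T then Suc (n x) else n x) (override_on g h T)"
  using assms(3-)
proof (induction T rule: finite_induct)
  case empty
  then show ?case using assms(2) by simp
next
  case (insert s T)
  let ?g = "override_on g h T" and ?n = "\<lambda>x. if x \<in> T then Suc (n x) else n x"
  have rec: "recolors E k W f ?n ?g"
    by (rule insert.IH) (use insert.prems in \<open>auto simp: independent_def\<close>)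
  have P: "proper_on E k W ?g"
    using rec by (rule recolors_proper)
  have s: "s \<in> W" "h s \<in> {1..k}" "(s, s) \<notin> E"
    using insert.prems by (auto simp: independent_def)
  have nb: "?g y \<noteq> h s" if "y \<in> W" "(s, y) \<in> E" for y
  proof -
    have "y \<notin> T"
      using that insert.prems(2) by (auto simp: independent_def)
    moreover have "h s \<noteq> g y"
      using that insert.prems(4)[of s] by (auto simp: nbrs_def)
    ultimately show ?thesis by simp
  qed
  have "proper_on E k W (?g(s := h s))"
    unfolding proper_on_def
  proof (intro conjI ballI impI)
    show "?g(s := h s) \<in> W \<rightarrow> {1..k}"
      using P s by (auto simp: proper_on_def)
  next
    fix x y assume xy: "x \<in> W" "y \<in> W" "(x, y) \<in> E"
    then show "(?g(s := h s)) x \<noteq> (?g(s := h s)) y"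
      using P s nb[of x] nb[of y] symD[OF assms(1), of x y] by (auto simp: proper_on_def)
  qed
  from recolors.move[OF rec s(1) this]
  have "recolors E k W f (?n(s := Suc (?n s))) (?g(s := h s))" .
  moreover have "?n(s := Suc (?n s)) = (\<lambda>x. if x \<in> insert s T then Suc (n x) else n x)"
    using insert.hyps(2) by auto
  ultimately show ?case
    by (simp only: override_on_insert)
qed

lemma free_color_exists:
  assumes "finite M" "card M < k"
  shows "\<exists>c\<in>{1..k::nat}. c \<notin> M"
proof (rule ccontr)
  assume "\<not> ?thesis"
  then have "card {1..k} \<le> card M"
    using assms(1) by (intro card_mono) auto
  with assms(2) show False by simp
qed

text \<open>
  A vertex \<open>s \<in> S\<close> has to move only when one of its neighbours is about to take its color, hence
  at most as often as its neighbours together.  The two spare colors in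
  \<open>Suc (card (nbrs E W s)) < k\<close> are the color that \<open>s\<close> has to avoid in advance and the one to
  which it moves.
\<close>

lemma recolors_extend:
  assumes "sym E" "finite W" "S \<subseteq> W" "independent E S" "proper_on E k W f"
    and deg: "\<And>s. s \<in> S \<Longrightarrow> Suc (card (nbrs E W s)) < k"
    and "recolors E k (W - S) f n g"
  shows "\<exists>n' g'. recolors E k W f n' g' \<and> (\<forall>x\<in>W - S. g' x = g x \<and> n' x = n x)
    \<and> (\<forall>s\<in>S. n' s \<le> (\<Sum>w\<in>nbrs E W s. n w))"
  using assms(7)
proof (induction rule: recolors.induct)
  case start
  show ?case
    using recolors.start[OF assms(5)] by (intro exI[of _ "\<lambda>_. 0"] exI[of _ f]) auto
next
  case (move n g v c)
  then obtain n' g' where rec: "recolors E k W f n' g'"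
    and eq: "\<And>x. x \<in> W - S \<Longrightarrow> g' x = g x \<and> n' x = n x"
    and le: "\<And>s. s \<in> S \<Longrightarrow> n' s \<le> (\<Sum>w\<in>nbrs E W s. n w)"
    by blast
  have v: "v \<in> W" "v \<notin> S"
    using move.hyps by auto
  have c: "c \<in> {1..k}"
    using move.hyps(2,3) funcset_mem[of "g(v := c)" "W - S" "{1..k}" v]
    by (simp add: proper_on_def)
  define T where "T = {s \<in> S. (s, v) \<in> E \<and> g' s = c}"
  have TS: "T \<subseteq> S"
    by (auto simp: T_def)
  have "\<exists>b\<in>{1..k}. b \<notin> insert c (g' ` nbrs E W s)" if "s \<in> S" for s
  proof (rule free_color_exists)
    show "finite (insert c (g' ` nbrs E W s))"
      using assms(2) by simp
    have "card (g' ` nbrs E W s) \<le> card (nbrs E W s)"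
      using assms(2) by (simp add: card_image_le)
    moreover have "card (insert c (g' ` nbrs E W s)) \<le> Suc (card (g' ` nbrs E W s))"
      by (rule card_insert_le_m1) simp_all
    ultimately show "card (insert c (g' ` nbrs E W s)) < k"
      using deg[OF that] by linarith
  qed
  then obtain h where h: "\<And>s. s \<in> S \<Longrightarrow> h s \<in> {1..k} \<and> h s \<notin> insert c (g' ` nbrs E W s)"
    by metis
  let ?n = "\<lambda>x. if x \<in> T then Suc (n' x) else n' x" and ?g = "override_on g' h T"
  have rec2: "recolors E k W f ?n ?g"
  proof (rule recolors_independent[OF assms(1) rec])
    show "T \<subseteq> W"
      using TS assms(3) by blast
    then show "finite T"
      using assms(2) by (rule finite_subset)
    show "independent E T"
      using TS assms(4) unfolding independent_def by blast
  qed (use h TS in auto)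
  have P: "proper_on E k W ?g"
    using rec2 by (rule recolors_proper)
  have avoid: "?g y \<noteq> c" if "y \<in> W" "y \<noteq> v" "(y, v) \<in> E" for y
  proof (cases "y \<in> S")
    case True
    then show ?thesis
      using that h[of y] by (cases "y \<in> T") (auto simp: T_def)
  next
    case False
    then have "?g y = g y"
      using that TS eq[of y] by (auto simp: override_on_def)
    moreover have "(g(v := c)) y \<noteq> (g(v := c)) v"
      using move.hyps(2,3) that False unfolding proper_on_def by blast
    ultimately show ?thesis
      using that by simp
  qed
  have loop: "(v, v) \<notin> E"
    using move.hyps(2,3) unfolding proper_on_def by blast
  have "proper_on E k W (?g(v := c))"
    unfolding proper_on_def
  proof (intro conjI ballI impI)
    show "?g(v := c) \<in> W \<rightarrow> {1..k}"
      using P c by (auto simp: proper_on_def)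
  next
    fix x y assume xy: "x \<in> W" "y \<in> W" "(x, y) \<in> E"
    have yx: "(y, x) \<in> E"
      using xy assms(1) by (auto dest: symD)
    show "(?g(v := c)) x \<noteq> (?g(v := c)) y"
      using P xy yx loop avoid[of x] avoid[of y] unfolding proper_on_def
      by (cases "x = v"; cases "y = v") auto
  qed
  from recolors.move[OF rec2 v(1) this]
  have "recolors E k W f (?n(v := Suc (?n v))) (?g(v := c))" .
  moreover have "\<forall>x\<in>W - S. (?g(v := c)) x = (g(v := c)) x
      \<and> (?n(v := Suc (?n v))) x = (n(v := Suc (n v))) x"
    using eq TS v by (auto simp: override_on_def)
  moreover have "\<forall>s\<in>S. (?n(v := Suc (?n v))) s \<le> (\<Sum>w\<in>nbrs E W s. (n(v := Suc (n v))) w)"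
  proof
    fix s assume s: "s \<in> S"
    have fin: "finite (nbrs E W s)"
      using assms(2) by simp
    have mono: "(\<Sum>w\<in>nbrs E W s. n w) \<le> (\<Sum>w\<in>nbrs E W s. (n(v := Suc (n v))) w)"
      by (rule sum_mono) auto
    have "(\<Sum>w\<in>nbrs E W s. n w) < (\<Sum>w\<in>nbrs E W s. (n(v := Suc (n v))) w)" if "s \<in> T"
    proof (rule sum_strict_mono_ex1[OF fin])
      show "\<exists>w\<in>nbrs E W s. n w < (n(v := Suc (n v))) w"
        using that v by (intro bexI[of _ v]) (auto simp: T_def nbrs_def)
    qed auto
    then show "(?n(v := Suc (?n v))) s \<le> (\<Sum>w\<in>nbrs E W s. (n(v := Suc (n v))) w)"
      using le[OF s] mono s v by (cases "s \<in> T") fastforce+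
  qed
  ultimately show ?case by blast
qed

text \<open>
  One peeling step: after the extended sequence, \<open>S\<close> takes its target colors in one further move
  per vertex, which accounts for the successor in the bound.
\<close>

lemma recolors_peel:
  assumes "sym E" "finite W" "S \<subseteq> W" "independent E S" "proper_on E k W f" "proper_on E k W h"
    and "\<And>s. s \<in> S \<Longrightarrow> Suc (card (nbrs E W s)) < k"
    and "recolors E k (W - S) f n g" and "\<And>x. x \<in> W - S \<Longrightarrow> g x = h x"
  shows "\<exists>n' g'. recolors E k W f n' g' \<and> (\<forall>x\<in>W. g' x = h x) \<and> (\<forall>x\<in>W - S. n' x = n x)
    \<and> (\<forall>s\<in>S. n' s \<le> Suc (\<Sum>w\<in>nbrs E W s. n w))"
proof -
  obtain n' g' where rec: "recolors E k W f n' g'"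
    and eq: "\<And>x. x \<in> W - S \<Longrightarrow> g' x = g x \<and> n' x = n x"
    and le: "\<And>s. s \<in> S \<Longrightarrow> n' s \<le> (\<Sum>w\<in>nbrs E W s. n w)"
    using recolors_extend[OF assms(1-5,7,8)] by blast
  have "recolors E k W f (\<lambda>x. if x \<in> S then Suc (n' x) else n' x) (override_on g' h S)"
  proof (rule recolors_independent[OF assms(1) rec])
    show "finite S"
      using assms(2,3) finite_subset by blast
  next
    fix s assume s: "s \<in> S"
    show "h s \<in> {1..k}"
      using s assms(3,6) by (auto simp: proper_on_def)
    show "h s \<notin> g' ` nbrs E W s"
    proof
      assume "h s \<in> g' ` nbrs E W s"
      then obtain w where w: "w \<in> W" "(s, w) \<in> E" "h s = g' w"
        by (auto simp: nbrs_def)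
      moreover have "w \<notin> S"
        using s w assms(4) by (auto simp: independent_def)
      ultimately have "h s = h w"
        using eq[of w] assms(9)[of w] by simp
      then show False
        using s w assms(3,6) by (auto simp: proper_on_def)
    qed
  qed (use assms in auto)
  moreover have "\<forall>x\<in>W. override_on g' h S x = h x"
    using eq assms(9) by (auto simp: override_on_def)
  ultimately show ?thesis
    using eq le by (intro exI conjI) auto
qed

section \<open>A polynomial bound on the number of moves per vertex\<close>

text \<open>
  This is the inequality \<open>(d - 1) m\<^sup>a + 1 \<le> d m\<^sup>a \<le> d q\<^sup>a N\<^sup>a \<le> N\<^sup>a\<close> for the sizes \<open>N\<close> of \<open>W\<close> and
  \<open>m \<le> q N\<close> of \<open>W - S\<close>.
\<close>

lemma peeling_recurrence:
  fixes q :: real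
  assumes "1 \<le> m" "real m \<le> q * real N" "real d * q ^ a \<le> 1" "D < d"
  shows "D * m ^ a + 1 \<le> N ^ a"
proof -
  have "D * m ^ a + 1 \<le> Suc D * m ^ a"
    using assms(1) by simp
  also have "\<dots> \<le> d * m ^ a"
    using assms(4) by (intro mult_right_mono) auto
  finally have "real (D * m ^ a + 1) \<le> real d * real m ^ a"
    by (simp flip: of_nat_mult of_nat_power)
  also have "\<dots> \<le> real d * (q * real N) ^ a"
    using assms(2) by (intro mult_left_mono power_mono) auto
  also have "\<dots> = (real d * q ^ a) * real N ^ a"
    by (simp add: power_mult_distrib)
  also have "\<dots> \<le> 1 * real N ^ a"
    using assms(3) by (intro mult_right_mono) auto
  finally have "real (D * m ^ a + 1) \<le> real (N ^ a)"
    by simp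
  then show ?thesis
    by (simp only: of_nat_le_iff)
qed

lemma recolors_bounded:
  fixes \<epsilon> :: real
  assumes "finite V" "sym E" "irrefl E" "0 < d" "0 < \<epsilon>" "d < k"
    and sparse: "\<And>W. W \<subseteq> V \<Longrightarrow> W \<noteq> {} \<Longrightarrow>
      real (card (E \<inter> W \<times> W)) \<le> (real d - \<epsilon>) * real (card W)"
    and a: "real d * (1 - \<epsilon> / (real d)\<^sup>2) ^ a \<le> 1"
    and "W \<subseteq> V" "proper_on E k W f" "proper_on E k W h"
  shows "\<exists>n g. recolors E k W f n g \<and> (\<forall>x\<in>W. g x = h x \<and> n x \<le> card W ^ a)"
  using assms(9-11)
proof (induction "card W" arbitrary: W rule: less_induct)
  case less
  show ?case
  proof (cases "W = {}")
    case True
    then show ?thesis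
      using recolors.start[OF less.prems(2)] by blast
  next
    case False
    have fin: "finite W"
      using less.prems assms(1) finite_subset by blast
    obtain S where S: "S \<subseteq> W" "independent E S" "\<And>s. s \<in> S \<Longrightarrow> card (nbrs E W s) < d"
      and big: "\<epsilon> / (real d)\<^sup>2 * real (card W) \<le> real (card S)"
      using large_independent_low_degree_set[OF fin assms(2-4) sparse[OF less.prems(1) False]]
      by blast
    have cW: "card W > 0"
      using fin False by (simp add: card_gt_0_iff)
    have "0 < \<epsilon> / (real d)\<^sup>2 * real (card W)"
      using assms(4,5) cW by simp
    then have cS: "card S > 0"
      using big by linarith
    have card_diff: "card (W - S) = card W - card S" "card S \<le> card W"
      using S(1) fin by (auto simp: card_Diff_subset finite_subset card_mono)
    have shrink: "real (card (W - S)) \<le> (1 - \<epsilon> / (real d)\<^sup>2) * real (card W)"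
      using big card_diff by (simp add: of_nat_diff algebra_simps)
    have "card (W - S) < card W"
      using card_diff cS cW by linarith
    then obtain n g where rec: "recolors E k (W - S) f n g"
      and g: "\<And>x. x \<in> W - S \<Longrightarrow> g x = h x"
      and n: "\<And>x. x \<in> W - S \<Longrightarrow> n x \<le> card (W - S) ^ a"
      using less.hyps[of "W - S"] less.prems proper_on_subset[of E k W _ "W - S"] by blast
    have "Suc (card (nbrs E W s)) < k" if "s \<in> S" for s
      using S(3)[OF that] assms(6) by linarith
    then obtain n' g' where rec': "recolors E k W f n' g'" and g': "\<forall>x\<in>W. g' x = h x"
      and n'_old: "\<And>x. x \<in> W - S \<Longrightarrow> n' x = n x"
      and n'_new: "\<And>s. s \<in> S \<Longrightarrow> n' s \<le> Suc (\<Sum>w\<in>nbrs E W s. n w)"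
      using recolors_peel[OF assms(2) fin S(1,2) less.prems(2,3) _ rec g] by blast
    have "n' x \<le> card W ^ a" if x: "x \<in> W" for x
    proof (cases "x \<in> S")
      case False
      then have "n' x \<le> card (W - S) ^ a"
        using n'_old n x by simp
      also have "\<dots> \<le> card W ^ a"
        using card_diff by (intro power_mono) auto
      finally show ?thesis .
    next
      case True
      have sub: "nbrs E W x \<subseteq> W - S"
        using True S(2) by (auto simp: nbrs_def independent_def)
      (* The recurrence requires W - S to be nonempty, which a neighbour of x guarantees. *)
      show ?thesis
      proof (cases "nbrs E W x = {}")
        case True
        then have "n' x \<le> 1"
          using n'_new[OF \<open>x \<in> S\<close>] by simp
        also have "1 \<le> card W ^ a"
          using cW by (simp add: Suc_le_eq)
        finally show ?thesis .
      next
        case False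
        then have "1 \<le> card (W - S)"
          using sub fin by (metis One_nat_def Suc_leI card_gt_0_iff finite_Diff subset_empty)
        have "(\<Sum>w\<in>nbrs E W x. n w) \<le> of_nat (card (nbrs E W x)) * card (W - S) ^ a"
          using sub n by (intro sum_bounded_above) blast
        then have "n' x \<le> card (nbrs E W x) * card (W - S) ^ a + 1"
          using n'_new[OF True] by simp
        also have "\<dots> \<le> card W ^ a"
          by (rule peeling_recurrence[OF \<open>1 \<le> card (W - S)\<close> shrink a S(3)[OF True]])
        finally show ?thesis .
      qed
    qed
    with rec' g' show ?thesis by blast
  qed
qed

section \<open>Distances in the recoloring graph\<close>

lemma proper_colorings_iff:
  assumes "pair_graph G"
  shows "f \<in> proper_colorings k G
    \<longleftrightarrow> f \<in> extensional (pverts G) \<and> proper_on (parcs G) k (pverts G) f"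
proof -
  interpret pair_graph G by fact
  show ?thesis
    using in_arcsD1 in_arcsD2
    by (fastforce simp: proper_colorings_def proper_on_def PiE_def)
qed

text \<open>
  Moves that change nothing are not arcs of the recoloring graph, so the walk may be shorter than
  the sequence of moves.
\<close>

lemma recolors_imp_walk:
  assumes "pair_graph G" "f \<in> proper_colorings k G"
    and "recolors (parcs G) k (pverts G) f n g"
  shows "g \<in> proper_colorings k G
    \<and> (\<exists>p. pre_digraph.awalk (with_proj (recoloring_graph k G)) f p g
          \<and> length p \<le> (\<Sum>v\<in>pverts G. n v))"
proof -
  interpret G: pair_graph G by fact
  interpret R: pair_graph "recoloring_graph k G"
    by (rule pair_graph_recoloring_graph) (rule G.pair_finite_verts)
  have verts: "pverts (recoloring_graph k G) = proper_colorings k G"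
    by (simp add: recoloring_graph_def)
  show ?thesis
    using assms(3)
  proof (induction rule: recolors.induct)
    case start
    have "R.awalk f [] f"
      using assms(2) by (simp add: R.awalk_Nil_iff verts)
    then show ?case
      using assms(2) by force
  next
    case (move n g v c)
    then obtain p where g: "g \<in> proper_colorings k G" and p: "R.awalk f p g"
      and len: "length p \<le> (\<Sum>v\<in>pverts G. n v)"
      by blast
    let ?g = "g(v := c)"
    have g': "?g \<in> proper_colorings k G"
      using g move.hyps(2,3)
      by (auto simp: proper_colorings_iff[OF assms(1)] extensional_def)
    have "(\<Sum>w\<in>pverts G. n w) < (\<Sum>w\<in>pverts G. (n(v := Suc (n v))) w)"
      using G.pair_finite_verts move.hyps(2) by (intro sum_strict_mono_ex1) auto
    then have len': "Suc (length p) \<le> (\<Sum>w\<in>pverts G. (n(v := Suc (n v))) w)"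
      using len by linarith
    have "\<exists>p. R.awalk f p ?g \<and> length p \<le> (\<Sum>w\<in>pverts G. (n(v := Suc (n v))) w)"
    proof (cases "g v = c")
      case True
      then have "?g = g" by auto
      then show ?thesis
        using p len' by (intro exI[of _ p]) simp
    next
      case False
      then have arc: "(g, ?g) \<in> parcs (recoloring_graph k G)"
        using g g' move.hyps(2) by (auto simp: recoloring_graph_def)
      then have "R.awalk g [(g, ?g)] ?g"
        using g' by (simp add: R.awalk_Cons_iff R.awalk_Nil_iff verts)
      then have "R.awalk f (p @ [(g, ?g)]) ?g"
        using p by (rule R.awalk_appendI[rotated])
      then show ?thesis
        using len' by (intro exI[of _ "p @ [(g, ?g)]"]) simp
    qed
    with g' show ?case by blast
  qed
qed

lemma recolors_imp_dist_le:
  assumes "pair_graph G" "f \<in> proper_colorings k G" "h \<in> proper_colorings k G"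
    and rec: "recolors (parcs G) k (pverts G) f n g"
    and "\<And>x. x \<in> pverts G \<Longrightarrow> g x = h x"
  shows "graph_dist (recoloring_graph k G) f h \<le> ereal (real (\<Sum>v\<in>pverts G. n v))"
proof -
  interpret G: pair_graph G by fact
  interpret R: pair_graph "recoloring_graph k G"
    by (rule pair_graph_recoloring_graph) (rule G.pair_finite_verts)
  obtain p where g: "g \<in> proper_colorings k G" and p: "R.awalk f p g"
    and len: "length p \<le> (\<Sum>v\<in>pverts G. n v)"
    using recolors_imp_walk[OF assms(1,2) rec] by blast
  have "g = h"
    using g assms(3,5) by (intro extensionalityI[of _ "pverts G"])
      (auto simp: proper_colorings_iff[OF assms(1)])
  have "R.awalk_cost (\<lambda>_. 1) p = real (length p)"
    by (simp add: R.awalk_cost_def sum_list_triv)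
  then have "graph_dist (recoloring_graph k G) f h \<le> ereal (real (length p))"
    using R.min_cost_le_walk_cost[OF p, of "\<lambda>_. 1"] \<open>g = h\<close> by (simp add: graph_dist_def)
  also have "\<dots> \<le> ereal (real (\<Sum>v\<in>pverts G. n v))"
    using len by (simp only: ereal_less_eq of_nat_le_iff)
  finally show ?thesis .
qed

section \<open>Sparsity from the maximum average degree\<close>

lemma card_arcs_le_twice_uedges:
  assumes "finite (parcs H)"
  shows "card (parcs H) \<le> 2 * card (uedges H)"
proof -
  let ?F = "\<lambda>e. {(x, y). {x, y} = e}"
  have "uedges H = (\<lambda>(u, v). {u, v}) ` parcs H"
    by (auto simp: uedges_def)
  then have fin: "finite (uedges H)"
    using assms by simp
  have fibre: "finite (?F e) \<and> card (?F e) \<le> 2" if e: "e \<in> uedges H" for e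
  proof -
    obtain u v where "e = {u, v}"
      using e by (auto simp: uedges_def)
    then have "?F e \<subseteq> {(u, v), (v, u)}"
      by (auto simp: doubleton_eq_iff)
    then have "finite (?F e)" "card (?F e) \<le> card {(u, v), (v, u)}"
      by (rule finite_subset card_mono[rotated], simp)+
    moreover have "card {(u, v), (v, u)} \<le> 2"
      by (rule card_insert_le_m1) simp_all
    ultimately show ?thesis by linarith
  qed
  have "parcs H \<subseteq> (\<Union>e\<in>uedges H. ?F e)"
    by (auto simp: uedges_def)
  then have "card (parcs H) \<le> card (\<Union>e\<in>uedges H. ?F e)"
    using fin fibre by (intro card_mono) auto
  also have "\<dots> \<le> (\<Sum>e\<in>uedges H. card (?F e))"
    using fin by (rule card_UN_le)
  also have "\<dots> \<le> of_nat (card (uedges H)) * 2"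
    using fibre by (intro sum_bounded_above) blast
  finally show ?thesis by simp
qed

text \<open>
  Every edge inside \<open>W\<close> is represented by two arcs, so the left-hand side is the degree sum of the
  induced subgraph, and only this subgraph enters from the maximum in \<open>mad\<close>.
\<close>

lemma sparse_if_mad_le:
  assumes "pair_graph G" "mad G \<le> r" "W \<subseteq> pverts G" "W \<noteq> {}"
  shows "real (card (parcs G \<inter> W \<times> W)) \<le> r * real (card W)"
proof -
  interpret G: pair_graph G by fact
  define H where "H = \<lparr>pverts = W, parcs = parcs G \<inter> W \<times> W\<rparr>"
  have "finite W"
    using assms(3) G.pair_finite_verts finite_subset by blast
  have symG: "sym (parcs G)"
    using G.pair_sym_arcs by (simp add: symmetric_def)
  have H: "pair_graph H"
  proof (unfold_locales)
    show "symmetric H"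
      using symG by (auto simp: symmetric_def H_def sym_def)
  qed (use \<open>finite W\<close> G.pair_finite_arcs G.pair_no_loops in \<open>auto simp: H_def\<close>)
  then interpret H: pair_graph H .
  have "subgraph (with_proj H) (with_proj G)"
    using assms(3) G.wf_digraph H.wf_digraph
    by (auto simp: subgraph_def compatible_def H_def)
  then have mem: "H \<in> nonempty_subgraphs G"
    using H assms(4) by (simp add: nonempty_subgraphs_def H_def)
  have "2 * real (card (uedges H)) / real (card (pverts H)) \<le> mad G"
    unfolding mad_def using finite_nonempty_subgraphs[OF assms(1)] mem
    by (intro Max_ge) auto
  also have "\<dots> \<le> r"
    by (rule assms(2))
  finally have "2 * real (card (uedges H)) \<le> r * real (card W)"
    using \<open>finite W\<close> assms(4) by (simp add: H_def field_simps card_gt_0_iff)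
  moreover have "card (parcs H) \<le> 2 * card (uedges H)"
    by (rule card_arcs_le_twice_uedges) (rule H.pair_finite_arcs)
  ultimately show ?thesis
    by (simp add: H_def)
qed

section \<open>The diameter of the recoloring graph\<close>

lemma recoloring_diameter_le:
  fixes \<epsilon> :: real
  assumes "pair_graph G" "pverts G \<noteq> {}" "mad G \<le> real d - \<epsilon>" "0 < \<epsilon>" "d < k"
    and a: "real d * (1 - \<epsilon> / (real d)\<^sup>2) ^ a \<le> 1"
  shows "graph_diameter (recoloring_graph k G) \<le> ereal (real (card (pverts G) ^ Suc a))"
proof -
  interpret G: pair_graph G by fact
  let ?V = "pverts G" and ?E = "parcs G"
  have sparse: "real (card (?E \<inter> W \<times> W)) \<le> (real d - \<epsilon>) * real (card W)"
    if "W \<subseteq> ?V" "W \<noteq> {}" for W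
    using sparse_if_mad_le[OF assms(1,3) that] .
  (* An average degree is nonnegative, so the hypothesis on mad forces d to be positive. *)
  have "0 \<le> (real d - \<epsilon>) * real (card ?V)"
    using sparse[OF subset_refl assms(2)] by (rule order_trans[rotated]) simp
  moreover have "0 < real (card ?V)"
    using assms(2) G.pair_finite_verts by (simp add: card_gt_0_iff)
  ultimately have "0 \<le> real d - \<epsilon>"
    by (metis mult_neg_pos not_less)
  then have "0 < d"
    using assms(4) by linarith
  have E: "sym ?E" "irrefl ?E"
    using G.pair_sym_arcs by (simp_all add: symmetric_def irrefl_def) (use G.pair_no_loops in fastforce)
  have "graph_dist (recoloring_graph k G) f h \<le> ereal (real (card ?V ^ Suc a))"
    if f: "f \<in> proper_colorings k G" and h: "h \<in> proper_colorings k G" for f h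
  proof -
    have "proper_on ?E k ?V f" "proper_on ?E k ?V h"
      using f h by (auto simp: proper_colorings_iff[OF assms(1)])
    then obtain n g where rec: "recolors ?E k ?V f n g"
      and gn: "\<And>x. x \<in> ?V \<Longrightarrow> g x = h x \<and> n x \<le> card ?V ^ a"
      using recolors_bounded[OF G.pair_finite_verts E \<open>0 < d\<close> assms(4,5) sparse a subset_refl]
      by blast
    have "(\<Sum>v\<in>?V. n v) \<le> of_nat (card ?V) * card ?V ^ a"
      using gn by (intro sum_bounded_above) blast
    then have "(\<Sum>v\<in>?V. n v) \<le> card ?V ^ Suc a"
      by simp
    then have "ereal (real (\<Sum>v\<in>?V. n v)) \<le> ereal (real (card ?V ^ Suc a))"
      by (simp only: ereal_less_eq of_nat_le_iff)
    moreover have "graph_dist (recoloring_graph k G) f h \<le> ereal (real (\<Sum>v\<in>?V. n v))"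
      using gn by (intro recolors_imp_dist_le[OF assms(1) f h rec]) blast
    ultimately show ?thesis
      by (rule order_trans[rotated])
  qed
  then show ?thesis
    unfolding graph_diameter_def by (intro SUP_least) (auto simp: recoloring_graph_def)
qed

theorem theorem2:
  fixes d :: nat and \<epsilon> :: real
  assumes "\<epsilon> > 0"
  shows "\<exists>c::real. c \<ge> 1 \<and>
    (\<exists>C::real. \<forall>G :: 'a pair_pre_digraph. \<forall>k::nat.
       pair_graph G \<longrightarrow> pverts G \<noteq> {} \<longrightarrow> mad G \<le> real d - \<epsilon> \<longrightarrow> k \<ge> d + 1 \<longrightarrow>
       graph_diameter (recoloring_graph k G) \<le> ereal (C * real (card (pverts G)) powr c))"
proof -
  obtain a where a: "real d * (1 - \<epsilon> / (real d)\<^sup>2) ^ a \<le> 1"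
  proof (cases "d = 0")
    case False
    then have "1 - \<epsilon> / (real d)\<^sup>2 < 1"
      using assms by simp
    then obtain a where "(1 - \<epsilon> / (real d)\<^sup>2) ^ a < 1 / real d"
      using real_arch_pow_inv[of "1 / real d" "1 - \<epsilon> / (real d)\<^sup>2"] False by auto
    then have "real d * (1 - \<epsilon> / (real d)\<^sup>2) ^ a \<le> 1"
      using False by (simp add: field_simps)
    then show thesis by (rule that)
  qed (use that in auto)
  show ?thesis
  proof (rule exI[of _ "real (Suc a)"], rule conjI, simp, rule exI[of _ 1], intro allI impI)
    fix G :: "'a pair_pre_digraph" and k :: nat
    assume G: "pair_graph G" "pverts G \<noteq> {}" "mad G \<le> real d - \<epsilon>" "k \<ge> d + 1"
    interpret G: pair_graph G by fact
    have "0 < real (card (pverts G))"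
      using G(2) G.pair_finite_verts by (simp add: card_gt_0_iff)
    then have "real (card (pverts G)) powr real (Suc a) = real (card (pverts G) ^ Suc a)"
      by (simp only: powr_realpow of_nat_power)
    moreover have "graph_diameter (recoloring_graph k G) \<le> ereal (real (card (pverts G) ^ Suc a))"
      using G assms by (intro recoloring_diameter_le[OF _ _ _ _ _ a]) auto
    ultimately show "graph_diameter (recoloring_graph k G)
        \<le> ereal (1 * real (card (pverts G)) powr real (Suc a))"
      by simp
  qed
qed

end
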